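(* Let $P$ be a finite poset and $A$ any subset of its ground set. For $B\subseteq A$ put $A\downarrow_P B=(A\setminus B)P\cup PB$. Then $$d(P)\le\sum_{B\subseteq A} d\bigl(P-A\downarrow_P B\bigr),$$ and equality holds whenever $A$ is an antichain.
   Context: For a finite poset $P$, $d(P)$ is the number of downsets of $P$ (with $d$ of the empty poset equal to $1$). For a subset $S$ of the ground set, $PS=\{x\mid x\le_P s\text{ for some } s\in S\}$ is the down-closure and $SP=\{x\mid s\le_P x\text{ for some } s\in S\}$ the up-closure; $P-S$ denotes the subposet induced on the complement of $S$. *)

theory Defs
  imports Main
begin

text \<open>
  A poset is given by its reflexive order relation \<open>r\<close> (with \<open>(x, y) \<in> r\<close> meaning \<open>x \<le> y\<close>),
  i.e. \<open>Partial_order r\<close>; by reflexivity its ground set is exactly \<open>Field r\<close>.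
\<close>

text \<open>
  The library predicate \<open>ofilter r D\<close> says that \<open>D \<subseteq> Field r\<close> and \<open>D\<close> contains every element
  below one of its members, i.e. that \<open>D\<close> is a downset.
\<close>
definition num_downsets :: "'a rel \<Rightarrow> nat" where
  "num_downsets r = card {D. ofilter r D}"

definition down_closure :: "'a rel \<Rightarrow> 'a set \<Rightarrow> 'a set" where
  "down_closure r S = {x. \<exists>s\<in>S. (x, s) \<in> r}"

definition up_closure :: "'a rel \<Rightarrow> 'a set \<Rightarrow> 'a set" where
  "up_closure r S = {x. \<exists>s\<in>S. (s, x) \<in> r}"

definition poset_minus :: "'a rel \<Rightarrow> 'a set \<Rightarrow> 'a rel" where
  "poset_minus r S = Restr r (Field r - S)"

definition arrow_set :: "'a rel \<Rightarrow> 'a set \<Rightarrow> 'a set \<Rightarrow> 'a set" where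
  "arrow_set r A B = up_closure r (A - B) \<union> down_closure r B"

definition antichain :: "'a rel \<Rightarrow> 'a set \<Rightarrow> bool" where
  "antichain r A \<longleftrightarrow> A \<subseteq> Field r \<and> (\<forall>x\<in>A. \<forall>y\<in>A. (x, y) \<in> r \<longrightarrow> x = y)"

lemma num_downsets_empty: "num_downsets {} = 1"
proof -
  have "{D. ofilter {} D} = {{} :: 'a set}"
    by (auto simp: ofilter_def)
  then show ?thesis by (simp add: num_downsets_def)
qed

lemma poset_minus_partial_order:
  assumes "Partial_order r"
  shows "Field (poset_minus r S) = Field r - S" and "Partial_order (poset_minus r S)"
proof -
  have refl: "(x, x) \<in> r" if "x \<in> Field r" for x
    using assms that by (auto simp: order_on_defs refl_on_def)
  show "Field (poset_minus r S) = Field r - S"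
    using refl by (auto simp: poset_minus_def Field_def)
  then show "Partial_order (poset_minus r S)"
    using assms refl
    by (auto simp: order_on_defs refl_on_def poset_minus_def
        intro: trans_Restr antisym_subset)
qed

end

theory Submission
  imports Defs
begin

text \<open>
  A downset \<open>D\<close> with \<open>D \<inter> A = B\<close> contains the down-closure of \<open>B\<close> and avoids the up-closure of
  \<open>A - B\<close>, so it is recovered from \<open>B\<close> and its trace outside \<open>arrow_set r A B\<close>. Conversely, adding
  the down-closure of \<open>B\<close> to a downset of the remaining poset gives a downset of the whole poset,
  and this meets an antichain \<open>A\<close> exactly in \<open>B\<close>.
\<close>

lemma ofilter_iff:
  "ofilter r D \<longleftrightarrow> D \<subseteq> Field r \<and> (\<forall>x y. y \<in> D \<longrightarrow> (x, y) \<in> r \<longrightarrow> x \<in> D)"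
  by (auto simp: ofilter_def under_def)

lemma ofilter_poset_minus_iff:
  assumes "Partial_order r"
  shows "ofilter (poset_minus r S) E \<longleftrightarrow>
    E \<subseteq> Field r - S \<and> (\<forall>x y. y \<in> E \<longrightarrow> (x, y) \<in> r \<longrightarrow> x \<notin> S \<longrightarrow> x \<in> E)"
  unfolding ofilter_iff poset_minus_partial_order(1)[OF assms]
  unfolding poset_minus_def by (blast intro: FieldI1)

lemma finite_ofilters:
  assumes "finite (Field r)"
  shows "finite {D. ofilter r D}"
  by (rule finite_subset[of _ "Pow (Field r)"]) (use assms in \<open>auto simp: ofilter_iff\<close>)

lemma ofilter_trace_poset_minus:
  assumes "Partial_order r" "ofilter r D"
  shows "ofilter (poset_minus r S) (D - S)"
  using assms(2) unfolding ofilter_poset_minus_iff[OF assms(1)] ofilter_iff[of r] by blast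

text \<open>Since \<open>D\<close> is closed downwards, no member of \<open>D\<close> lies above a
  point of \<open>A - D\<close>. Hence the part of \<open>D\<close> inside the arrow set lies in
  \<open>down_closure r (D \<inter> A)\<close>, which is itself contained in
  \<open>D\<close>.\<close>

lemma ofilter_eq_trace_Un_down_closure:
  assumes "ofilter r D"
  shows "D = (D - arrow_set r A (D \<inter> A)) \<union> down_closure r (D \<inter> A)"
  using assms by (auto simp: ofilter_iff arrow_set_def up_closure_def down_closure_def)

text \<open>By reflexivity each point of \<open>A\<close> lies in the closure of its own part,
  \<open>A - B\<close> or \<open>B\<close>. So a downset of the remaining poset cannot meet
  \<open>A\<close>.\<close>

lemma subset_arrow_set:
  assumes "Partial_order r" "A \<subseteq> Field r"
  shows "A \<subseteq> arrow_set r A B"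
proof -
  have "(x, x) \<in> r" if "x \<in> A" for x
    using assms that by (auto simp: order_on_defs refl_on_def)
  then show ?thesis
    by (auto simp: arrow_set_def up_closure_def down_closure_def)
qed

lemma ofilter_Un_down_closure:
  assumes po: "Partial_order r" and E: "ofilter (poset_minus r (arrow_set r A B)) E"
  shows "ofilter r (E \<union> down_closure r B)"
proof -
  have tr: "(x, z) \<in> r" if "(x, y) \<in> r" "(y, z) \<in> r" for x y z
    using po that unfolding order_on_defs by (meson transD)
  have "x \<in> E \<union> down_closure r B" if "y \<in> E" "(x, y) \<in> r" for x y
  proof (cases "x \<in> arrow_set r A B")
    case True
    \<comment> \<open>The point \<open>y\<close> survived the removal, and anything above a point of
      an up-closure is in it too, so \<open>x\<close> can only have been removed through
      \<open>down_closure r B\<close>.\<close>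
    have "y \<notin> up_closure r (A - B)"
      using E that(1) unfolding ofilter_poset_minus_iff[OF po] arrow_set_def by blast
    then have "x \<notin> up_closure r (A - B)"
      using tr that(2) unfolding up_closure_def by blast
    then show ?thesis using True by (simp add: arrow_set_def)
  next
    case False
    then show ?thesis using E that unfolding ofilter_poset_minus_iff[OF po] by blast
  qed
  moreover have "x \<in> down_closure r B" if "y \<in> down_closure r B" "(x, y) \<in> r" for x y
    using tr that unfolding down_closure_def by blast
  moreover have "E \<union> down_closure r B \<subseteq> Field r"
    using E unfolding ofilter_poset_minus_iff[OF po] by (auto simp: down_closure_def Field_def)
  ultimately show ?thesis unfolding ofilter_iff by blast
qed

text \<open>This is where incomparability enters: for a < b in \<open>A\<close> and \<open>B\<close>
  = {b}, the down-closure would also pick up a, and no downset would have trace \<open>B\<close> on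
  \<open>A\<close>.\<close>

lemma antichain_Int_down_closure:
  assumes "Partial_order r" "antichain r A" "B \<subseteq> A"
  shows "down_closure r B \<inter> A = B"
proof -
  have "(x, x) \<in> r" if "x \<in> A" for x
    using assms that by (auto simp: order_on_defs refl_on_def antichain_def)
  then show ?thesis
    using assms(2,3) unfolding antichain_def down_closure_def by blast
qed

theorem theorem3p1:
  fixes r :: "'a rel" and A :: "'a set"
  assumes "Partial_order r" and "finite (Field r)" and "A \<subseteq> Field r"
  shows "num_downsets r \<le> (\<Sum>B\<in>Pow A. num_downsets (poset_minus r (arrow_set r A B)))
    \<and> (antichain r A \<longrightarrow>
        num_downsets r = (\<Sum>B\<in>Pow A. num_downsets (poset_minus r (arrow_set r A B))))"
proof -
  \<comment> \<open>The disjoint union over \<open>B\<close> turns the right-hand sum into one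
    cardinality, so the inequality becomes injectivity of \<open>f\<close> into \<open>T\<close> and
    the equality its surjectivity.\<close>
  define T where "T = (SIGMA B:Pow A. {E. ofilter (poset_minus r (arrow_set r A B)) E})"
  define f where "f D = (D \<inter> A, D - arrow_set r A (D \<inter> A))" for D
  have finA: "finite (Pow A)"
    using assms(2,3) finite_subset by auto
  have fin: "finite {E. ofilter (poset_minus r S) E}" for S
    by (rule finite_ofilters) (simp add: poset_minus_partial_order(1)[OF assms(1)] assms(2))
  have finT: "finite T"
    unfolding T_def using finA fin by blast
  have card_T: "card T = (\<Sum>B\<in>Pow A. num_downsets (poset_minus r (arrow_set r A B)))"
    unfolding T_def num_downsets_def using finA fin by (subst card_SigmaI) auto
  have inj: "inj_on f {D. ofilter r D}"
    using ofilter_eq_trace_Un_down_closure[of r _ A]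
    by (intro inj_onI) (simp add: f_def, metis)
  have sub: "f ` {D. ofilter r D} \<subseteq> T"
    using ofilter_trace_poset_minus[OF assms(1)] by (auto simp: f_def T_def)
  have "num_downsets r \<le> card T"
    unfolding num_downsets_def by (rule card_inj_on_le[OF inj sub finT])
  moreover have "num_downsets r = card T" if anti: "antichain r A"
  proof -
    have "(B, E) \<in> f ` {D. ofilter r D}" if "(B, E) \<in> T" for B E
    proof
      have B: "B \<subseteq> A" and E: "ofilter (poset_minus r (arrow_set r A B)) E"
        using that by (auto simp: T_def)
      have disj: "E \<inter> arrow_set r A B = {}"
        using E unfolding ofilter_poset_minus_iff[OF assms(1)] by blast
      have "(E \<union> down_closure r B) \<inter> A = B"
        using disj subset_arrow_set[OF assms(1,3)]
          antichain_Int_down_closure[OF assms(1) anti B] by blast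
      \<comment> \<open>The added down-closure is part of the arrow set, so the subtraction removes
        it and leaves \<open>E\<close> intact.\<close>
      moreover have "(E \<union> down_closure r B) - arrow_set r A B = E"
        using disj by (auto simp: arrow_set_def)
      ultimately show "(B, E) = f (E \<union> down_closure r B)"
        by (simp add: f_def)
      show "E \<union> down_closure r B \<in> {D. ofilter r D}"
        using ofilter_Un_down_closure[OF assms(1) E] by simp
    qed
    then have "f ` {D. ofilter r D} = T"
      using sub by auto
    then show ?thesis
      unfolding num_downsets_def using card_image[OF inj] by simp
  qed
  ultimately show ?thesis
    unfolding card_T by blast
qed

end
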